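(* Consider the homogeneous initial-value problem $$\sum_{i=1}^\ell q_i\,D_t^{\alpha_i}y(t)+\lambda y(t)=0\quad\text{for }0<t\le T,\qquad y(0)=1,$$ where the $q_i$ are constants and $\lambda\ge0$. Then this problem has a solution $y$, with $y(t)\ge0$ for $t\in[0,T]$.
   Context: $T>0$; $\ell$ is a positive integer; $0<\alpha_\ell<\dots<\alpha_2<\alpha_1\le1$ are constants; the $q_i$ satisfy $q_i\ge0$ for each $i$ and $\sum_{i=1}^\ell q_i>0$. $D_t^1y:=y'$, and for $0<\alpha_i<1$ the Caputo derivative is $$D_t^{\alpha_i}y(t)=\frac1{\Gamma(1-\alpha_i)}\int_0^t(t-s)^{-\alpha_i}y'(s)\,ds,\qquad t>0,$$ or equivalently, after integration by parts, $\Gamma(1-\alpha_i)D_t^{\alpha_i}y(t)=t^{-\alpha_i}[y(t)-y(0)]+\int_0^t\alpha_i(t-s)^{-\alpha_i-1}[y(t)-y(s)]\,ds$. Solutions are understood to be in $C[0,T]\cap W^{1,\infty}(\epsilon,t)$ for all $0<\epsilon<t\le T$ (with, if $\alpha_1=1$, $y'$ left-continuous on $(0,T]$). *)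

theory Defs
  imports "HOL-Analysis.Analysis"
begin

definition test_function :: "real set \<Rightarrow> (real \<Rightarrow> real) \<Rightarrow> bool" where
  "test_function S \<phi> \<longleftrightarrow>
     (\<forall>k x. (deriv ^^ k) \<phi> field_differentiable (at x)) \<and>
     (\<exists>K. compact K \<and> K \<subseteq> S \<and> (\<forall>x. x \<notin> K \<longrightarrow> \<phi> x = 0))"

definition locally_integrable :: "real set \<Rightarrow> (real \<Rightarrow> real) \<Rightarrow> bool" where
  "locally_integrable S f \<longleftrightarrow> (\<forall>K. compact K \<and> K \<subseteq> S \<longrightarrow> set_integrable lebesgue K f)"

definition weak_derivative :: "real set \<Rightarrow> (real \<Rightarrow> real) \<Rightarrow> (real \<Rightarrow> real) \<Rightarrow> bool" where
  "weak_derivative S y dy \<longleftrightarrow>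
     locally_integrable S y \<and> locally_integrable S dy \<and>
     (\<forall>\<phi>. test_function S \<phi> \<longrightarrow>
        (LINT x:S|lebesgue. y x * deriv \<phi> x) = - (LINT x:S|lebesgue. dy x * \<phi> x))"

definition L_inf :: "real set \<Rightarrow> (real \<Rightarrow> real) set" where
  "L_inf S = {f. set_borel_measurable lebesgue S f \<and>
                 (\<exists>C. AE x in lebesgue. x \<in> S \<longrightarrow> \<bar>f x\<bar> \<le> C)}"

definition W1_inf :: "real set \<Rightarrow> (real \<Rightarrow> real) set" where
  "W1_inf S = {y \<in> L_inf S. \<exists>dy \<in> L_inf S. weak_derivative S y dy}"

text \<open>
  The Caputo derivative is a function of (a representative \<open>dy\<close> of) the derivative of \<open>y\<close>.
  For \<open>a < 1\<close> only the almost-everywhere class of \<open>dy\<close> matters.  For \<open>a = 1\<close> the value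
  \<open>dy t\<close> itself is used; in a solution it is then pinned down by left-continuity of \<open>dy\<close>.
\<close>

definition caputo :: "real \<Rightarrow> (real \<Rightarrow> real) \<Rightarrow> real \<Rightarrow> real" where
  "caputo a dy t =
     (if a = 1 then dy t
      else 1 / Gamma (1 - a) * (LINT s:{0<..<t}|lebesgue. (t - s) powr (- a) * dy s))"

text \<open>
  Isabelle's integral is total, so existence of the Caputo derivative is a separate condition.
\<close>

definition caputo_exists :: "real \<Rightarrow> (real \<Rightarrow> real) \<Rightarrow> real \<Rightarrow> bool" where
  "caputo_exists a dy t \<longleftrightarrow>
     (a < 1 \<longrightarrow> set_integrable lebesgue {0<..<t} (\<lambda>s. (t - s) powr (- a) * dy s))"

definition multiterm_solution ::
  "real \<Rightarrow> nat \<Rightarrow> (nat \<Rightarrow> real) \<Rightarrow> (nat \<Rightarrow> real) \<Rightarrow> real \<Rightarrow> (real \<Rightarrow> real) \<Rightarrow> bool" where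
  "multiterm_solution T l \<alpha> q lam y \<longleftrightarrow>
     continuous_on {0..T} y \<and>
     (\<forall>\<epsilon> t. 0 < \<epsilon> \<and> \<epsilon> < t \<and> t \<le> T \<longrightarrow> y \<in> W1_inf {\<epsilon><..<t}) \<and>
     (\<exists>dy. weak_derivative {0<..<T} y dy \<and>
        (\<alpha> 1 = 1 \<longrightarrow> (\<forall>t\<in>{0<..T}. continuous (at_left t) dy)) \<and>
        (\<forall>t\<in>{0<..T}.
           (\<forall>i\<in>{1..l}. caputo_exists (\<alpha> i) dy t) \<and>
           (\<Sum>i=1..l. q i * caputo (\<alpha> i) dy t) + lam * y t = 0))"

end

theory Submission
  imports Defs
begin

text \<open>
  Write \<open>w\<^sub>a(t) = t powr (a - 1) / \<Gamma>(a)\<close> for the Riemann--Liouville kernel.  The kernels form a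
  convolution semigroup, \<open>w\<^sub>a * w\<^sub>b = w\<^bsub>a+b\<^esub>\<close>, and the Caputo derivative of order \<open>\<alpha> < 1\<close> of
  \<open>y\<close> is \<open>w\<^bsub>1-\<alpha>\<^esub> * y'\<close>.

  Existence.  Let \<open>m\<close> be the index of the highest order with \<open>q\<^sub>m > 0\<close>, put \<open>\<beta> = \<alpha>\<^sub>m\<close>, and count
  the zero-order term as one more summand, with \<open>\<alpha>\<^sub>0 = 0\<close> and \<open>q\<^sub>0 = \<lambda>\<close>.  With \<open>v = y'\<close> and
  \<open>y = 1 + w\<^sub>1 * v\<close> the equation reads \<open>\<Sum> q\<^sub>i w\<^bsub>1-\<alpha>\<^sub>i\<^esub> * v = - \<lambda> w\<^sub>1\<close>.  Dividing by \<open>q\<^sub>m w\<^bsub>1-\<beta>\<^esub>\<close>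
  gives the Volterra equation \<open>v + h * v = - (\<lambda>/q\<^sub>m) w\<^sub>\<beta>\<close> with
  \<open>h = \<Sum> (q\<^sub>i/q\<^sub>m) w\<^bsub>\<beta>-\<alpha>\<^sub>i\<^esub>\<close>, summed over the \<open>i \<noteq> m\<close> with \<open>q\<^sub>i \<noteq> 0\<close>.  It is solved by its Neumann series: for
  \<open>R\<^sub>a = \<Sum>n. (-1)^n h^n * w\<^sub>a\<close> (convolution powers) one has \<open>R\<^sub>a + h * R\<^sub>a = w\<^sub>a\<close>, and
  \<open>v = - (\<lambda>/q\<^sub>m) R\<^sub>\<beta>\<close>.  Every summand is a finite combination of kernels, so that convolution with
  \<open>w\<^sub>c\<close> just replaces \<open>R\<^sub>a\<close> by \<open>R\<^bsub>a+c\<^esub>\<close> (\<open>resolvent_convolution\<close>), and the multiterm equation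
  for \<open>v\<close> becomes the case \<open>a = 1\<close> of \<open>resolvent_equation\<close>.  Convergence, locally uniform on
  \<open>t > 0\<close>, follows by comparison with a geometric series from an estimate
  \<open>w\<^sub>a(t) \<le> C(S,t) S powr (-a)\<close> with \<open>S\<close> large (\<open>rl_kernel_bound\<close>).

  Nonnegativity.  If the minimum of \<open>y\<close> over \<open>{0..T}\<close> were negative, it would be attained at some
  \<open>t > 0\<close>.  Integration by parts shows that all Caputo derivatives of \<open>y\<close> at \<open>t\<close> are nonpositive
  (\<open>caputo_nonpos_at_minimum\<close>).  For \<open>\<lambda> > 0\<close> the left-hand side of the equation is then negative at
  \<open>t\<close>, a contradiction.  For \<open>\<lambda> = 0\<close> the solution constructed above is constantly \<open>1\<close>.
\<close>

section \<open>Riemann--Liouville kernels\<close>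

definition rl_kernel :: "real \<Rightarrow> real \<Rightarrow> real" where
  "rl_kernel a t = t powr (a - 1) / Gamma a"

lemma rl_kernel_nonneg: "a > 0 \<Longrightarrow> 0 \<le> rl_kernel a t"
  by (simp add: rl_kernel_def)

lemma rl_kernel_1: "t > 0 \<Longrightarrow> rl_kernel 1 t = 1"
  by (simp add: rl_kernel_def)

lemma continuous_on_rl_kernel: "continuous_on {0<..} (rl_kernel a)"
  unfolding rl_kernel_def divide_inverse by (intro continuous_intros) auto

text \<open>
  This is Euler's Beta integral, rescaled from \<open>{0..1}\<close> to \<open>{0..t}\<close>.  The open interval keeps away
  from the end points, where \<open>powr\<close> has the default value \<open>0\<close>.
\<close>

lemma rl_kernel_convolution:
  assumes "a > 0" "b > 0" "t > 0"
  shows "((\<lambda>s. rl_kernel a (t - s) * rl_kernel b s) has_integral rl_kernel (a + b) t) {0<..<t}"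
proof -
  have "((\<lambda>x. (x / t) powr (b - 1) * (1 - x / t) powr (a - 1)) has_integral t * Beta b a) {0..t}"
  proof -
    have im: "(\<lambda>x. x / (1 / t)) ` {0..1} = {0..t}"
    proof -
      have "(\<lambda>x. x / (1 / t)) ` {0..1} = (*) t ` {0..1}" by (simp add: mult.commute)
      then show ?thesis using assms(3) by (simp add: image_mult_atLeastAtMost)
    qed
    from has_integral_stretch_real[OF has_integral_Beta_real[OF assms(2,1)], of "1 / t"] assms(3) im
    show ?thesis by (simp add: mult.commute)
  qed
  then have "((\<lambda>x. (x / t) powr (b - 1) * (1 - x / t) powr (a - 1)) has_integral t * Beta b a) {0<..<t}"
    by (simp add: has_integral_Icc_iff_Ioo)
  from has_integral_mult_right[OF this, of "t powr (a + b - 2) / (Gamma a * Gamma b)"]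
  have *: "((\<lambda>x. t powr (a + b - 2) / (Gamma a * Gamma b) *
           ((x / t) powr (b - 1) * (1 - x / t) powr (a - 1))) has_integral
         t powr (a + b - 2) / (Gamma a * Gamma b) * (t * Beta b a)) {0<..<t}" .
  have e1: "t powr (a + b - 2) / (Gamma a * Gamma b) * ((x / t) powr (b - 1) * (1 - x / t) powr (a - 1))
     = rl_kernel a (t - x) * rl_kernel b x" if "x \<in> {0<..<t}" for x
  proof -
    have "(1 - x / t) = (t - x) / t" using assms(3) by (simp add: field_simps)
    moreover have "t powr (a + b - 2) = t powr (a - 1) * t powr (b - 1)"
      by (simp flip: powr_add)
    ultimately show ?thesis using that assms(3)
      by (simp add: rl_kernel_def powr_divide)
  qed
  have e2: "t powr (a + b - 2) / (Gamma a * Gamma b) * (t * Beta b a) = rl_kernel (a + b) t"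
  proof -
    have "t powr (a + b - 1) = t powr (a + b - 2) * t"
      using assms(3) powr_add[of t "a + b - 2" 1] by simp
    moreover have "Gamma a \<noteq> 0" "Gamma b \<noteq> 0" using assms Gamma_real_pos by (metis less_irrefl)+
    ultimately show ?thesis by (simp add: rl_kernel_def Beta_def add.commute)
  qed
  show ?thesis using has_integral_eq[OF e1 *] e2 by simp
qed

text \<open>
  In the Gamma integral of \<open>x powr g * exp (- x)\<close> keep only \<open>x \<ge> X\<close> and bound the power from below
  by \<open>X powr g\<close>.  This replaces Stirling's formula in the convergence proof.
\<close>

lemma powr_exp_le_Gamma:
  assumes "g \<ge> 0" "X \<ge> (0::real)"
  shows "X powr g * exp (- X) \<le> Gamma (g + 1)"
proof -
  have "((\<lambda>x::real. exp (- 1 * x)) has_integral exp (- 1 * X) / 1) {X..}"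
    by (rule has_integral_exp_minus_to_infinity) simp
  from has_integral_mult_right[OF this, of "X powr g"]
  have "((\<lambda>x. X powr g * exp (- x)) has_integral X powr g * exp (- X)) {X..}" by simp
  then have 1: "((\<lambda>x. if x \<in> {X..} then X powr g * exp (- x) else 0) has_integral X powr g * exp (- X)) {0..}"
    by (subst has_integral_restrict) (use assms in auto)
  have 2: "((\<lambda>t. t powr g / exp t) has_integral Gamma (g + 1)) {0..}"
    using Gamma_integral_real[of "g + 1"] assms by simp
  show ?thesis
    by (rule has_integral_le[OF 1 2])
      (use assms in \<open>auto simp: exp_minus field_simps intro: powr_mono2\<close>)
qed

text \<open>
  Exponential decay in the order \<open>g\<close>, at a rate \<open>ln S\<close> that is as large as desired and with a
  factor that does not depend on \<open>g\<close>: this makes series over kernels of growing order converge.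
\<close>

lemma rl_kernel_bound:
  assumes "g > 0" "S > 0" "t > 0"
  shows "rl_kernel g t \<le> exp (exp 1 * S * t) / t * S powr (- g)"
proof -
  \<comment> \<open>Writing \<open>1 / \<Gamma>(g) = g / \<Gamma>(g + 1)\<close> produces a factor \<open>g\<close>.  The \<open>exp 1\<close> in \<open>X\<close> contributes
    \<open>exp g \<ge> g\<close> to \<open>X powr g\<close> and so absorbs it.\<close>
  define X where "X = exp 1 * S * t"
  have "g \<le> exp g" using exp_ge_add_one_self[of g] by linarith
  have "g * (S powr g * t powr g * exp (- X)) \<le> exp g * (S powr g * t powr g * exp (- X))"
    by (intro mult_right_mono) (use \<open>g \<le> exp g\<close> in auto)
  also have "\<dots> = X powr g * exp (- X)"
    using assms by (simp add: X_def powr_mult exp_powr_real)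
  also have "\<dots> \<le> Gamma (g + 1)"
    by (rule powr_exp_le_Gamma) (use assms in \<open>auto simp: X_def\<close>)
  also have "\<dots> = g * Gamma g"
    using Gamma_plus1[of g] assms by (metis add.commute nonpos_Ints_nonpos not_le)
  finally have "S powr g * t powr g * exp (- X) \<le> Gamma g"
    using assms by simp
  then have "t powr g \<le> Gamma g * exp X * S powr (- g)"
    using assms by (simp add: exp_minus powr_minus field_simps)
  moreover have "t powr (g - 1) = t powr g / t"
    using assms by (simp add: powr_diff)
  ultimately show ?thesis
    using assms Gamma_real_pos[of g] by (simp add: rl_kernel_def X_def field_simps)
qed

section \<open>Iterated convolutions and the resolvent series\<close>

text \<open>
  The parameters encode the kernel \<open>h = (\<Sum>j\<in>I. p j * w\<^bsub>b j\<^esub>)\<close> of a Volterra equation.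
\<close>

locale volterra_kernel =
  fixes I :: "nat set" and p b :: "nat \<Rightarrow> real"
  assumes finite_I: "finite I"
    and p_nonneg: "j \<in> I \<Longrightarrow> 0 \<le> p j"
    and b_pos: "j \<in> I \<Longrightarrow> 0 < b j"
begin

text \<open>
  The function \<open>iterated_conv n a\<close> is \<open>h^n * w\<^sub>a\<close>, with the \<open>n\<close>-th convolution power of \<open>h\<close>.  By the
  semigroup law, one convolution with \<open>h\<close> amounts to shifting the order of the kernel, which gives
  a recursion without integrals.
\<close>

fun iterated_conv :: "nat \<Rightarrow> real \<Rightarrow> real \<Rightarrow> real" where
  "iterated_conv 0 a t = rl_kernel a t"
| "iterated_conv (Suc n) a t = (\<Sum>j\<in>I. p j * iterated_conv n (a + b j) t)"

lemma iterated_conv_nonneg: "a > 0 \<Longrightarrow> 0 \<le> iterated_conv n a t"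
proof (induction n arbitrary: a)
  case (Suc n)
  then show ?case by (auto intro!: sum_nonneg mult_nonneg_nonneg p_nonneg simp: b_pos add_pos_pos)
qed (simp add: rl_kernel_nonneg)

lemma continuous_on_iterated_conv: "continuous_on {0<..} (iterated_conv n a)"
proof (induction n arbitrary: a)
  case (Suc n)
  have "continuous_on {0<..} (\<lambda>t. \<Sum>j\<in>I. p j * iterated_conv n (a + b j) t)"
    by (intro continuous_intros Suc)
  then show ?case by (simp add: fun_eq_iff cong: continuous_on_cong)
qed (simp add: continuous_on_rl_kernel)

text \<open>
  Both factors are nonnegative, so that this integral is also the norm needed for exchanging
  integration and summation in \<open>resolvent_convolution\<close>.
\<close>

lemma iterated_conv_convolution:
  assumes "c > 0" "a > 0" "t > 0"
  shows "((\<lambda>s. rl_kernel c (t - s) * iterated_conv n a s) has_integral iterated_conv n (a + c) t) {0<..<t}"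
  using assms
proof (induction n arbitrary: a)
  case 0
  then show ?case using rl_kernel_convolution[of c a t] by (simp add: add.commute)
next
  case (Suc n)
  have "((\<lambda>s. \<Sum>j\<in>I. p j * (rl_kernel c (t - s) * iterated_conv n (a + b j) s)) has_integral
      (\<Sum>j\<in>I. p j * iterated_conv n (a + b j + c) t)) {0<..<t}"
    by (intro has_integral_sum has_integral_mult_right finite_I Suc.IH)
       (use Suc.prems b_pos in \<open>auto simp: add_pos_pos\<close>)
  then show ?case by (simp add: sum_distrib_left mult_ac add_ac)
qed

text \<open>
  The value \<open>ratio S\<close> is the Laplace transform of \<open>h\<close> at \<open>S\<close>; it
  is the ratio of the geometric series that dominates \<open>iterated_conv n a t\<close>.
\<close>

definition ratio :: "real \<Rightarrow> real" where
  "ratio S = (\<Sum>j\<in>I. p j * S powr (- b j))"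

lemma iterated_conv_bound:
  assumes "a > 0" "S > 0" "t > 0"
  shows "iterated_conv n a t \<le> exp (exp 1 * S * t) / t * S powr (- a) * ratio S ^ n"
  using assms(1)
proof (induction n arbitrary: a)
  case 0
  then show ?case using rl_kernel_bound[of a S t] assms by simp
next
  case (Suc n)
  have "iterated_conv (Suc n) a t \<le> (\<Sum>j\<in>I. p j * (exp (exp 1 * S * t) / t * S powr (- (a + b j)) * ratio S ^ n))"
    unfolding iterated_conv.simps
    by (intro sum_mono mult_left_mono Suc.IH) (use Suc.prems in \<open>auto simp: b_pos add_pos_pos p_nonneg\<close>)
  also have "\<dots> = (\<Sum>j\<in>I. (exp (exp 1 * S * t) / t * S powr (- a) * ratio S ^ n) * (p j * S powr (- b j)))"
  proof (intro sum.cong refl)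
    fix j
    have "S powr (- (a + b j)) = S powr (- a) * S powr (- b j)" by (simp flip: powr_add)
    then show "p j * (exp (exp 1 * S * t) / t * S powr (- (a + b j)) * ratio S ^ n) =
        exp (exp 1 * S * t) / t * S powr (- a) * ratio S ^ n * (p j * S powr (- b j))" by simp
  qed
  also have "\<dots> = (exp (exp 1 * S * t) / t * S powr (- a) * ratio S ^ n) * ratio S"
    unfolding sum_distrib_left[symmetric] ratio_def[symmetric] by (rule refl)
  finally show ?case by (simp add: mult_ac)
qed

text \<open>
  All exponents \<open>b j\<close> are positive, hence \<open>ratio S\<close> tends to \<open>0\<close> as \<open>S\<close> grows.
\<close>

lemma obtain_small_ratio: obtains S where "S > 0" "0 \<le> ratio S" "ratio S < 1"
proof -
  have "(ratio \<longlongrightarrow> (\<Sum>j\<in>I. p j * 0)) at_top"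
    unfolding ratio_def
    by (intro tendsto_intros tendsto_neg_powr filterlim_ident) (simp add: b_pos)
  then have "eventually (\<lambda>S. ratio S < 1) at_top"
    by (simp add: order_tendsto_iff)
  then have "eventually (\<lambda>S. ratio S < 1 \<and> S > 0) at_top"
    using eventually_gt_at_top by (rule eventually_conj)
  then obtain S where "ratio S < 1" "S > 0"
    by (metis (no_types, lifting) eventually_at_top_linorder order_refl)
  moreover have "0 \<le> ratio S"
    unfolding ratio_def by (intro sum_nonneg) (simp add: p_nonneg)
  ultimately show ?thesis using that by blast
qed

lemma summable_iterated_conv:
  assumes "a > 0" "t > 0"
  shows "summable (\<lambda>n. iterated_conv n a t)"
proof -
  obtain S where S: "S > 0" "0 \<le> ratio S" "ratio S < 1" using obtain_small_ratio .
  show ?thesis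
  proof (rule summable_comparison_test)
    show "\<exists>N. \<forall>n\<ge>N. norm (iterated_conv n a t) \<le> exp (exp 1 * S * t) / t * S powr (- a) * ratio S ^ n"
      using iterated_conv_bound iterated_conv_nonneg assms S by auto
    show "summable (\<lambda>n. exp (exp 1 * S * t) / t * S powr (- a) * ratio S ^ n)"
      using S by (intro summable_mult summable_geometric) auto
  qed
qed

text \<open>
  The Neumann series of the Volterra equation \<open>R + h * R = w\<^sub>a\<close>.
\<close>

definition resolvent :: "real \<Rightarrow> real \<Rightarrow> real" where
  "resolvent a t = (\<Sum>n. (- 1) ^ n * iterated_conv n a t)"

lemma summable_alternating_iterated_conv:
  assumes "a > 0" "t > 0"
  shows "summable (\<lambda>n. (- 1) ^ n * iterated_conv n a t)"
proof (rule summable_comparison_test[OF _ summable_iterated_conv[OF assms]])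
  show "\<exists>N. \<forall>n\<ge>N. norm ((- 1) ^ n * iterated_conv n a t) \<le> iterated_conv n a t"
    using iterated_conv_nonneg assms by (simp add: abs_mult power_abs)
qed

text \<open>
  The Volterra equation \<open>R\<^sub>a + h * R\<^sub>a = w\<^sub>a\<close> with the convolution already carried out.  By the
  recursion for \<open>iterated_conv\<close>, the terms from \<open>n = 1\<close> on of the first series cancel the second one.
\<close>

lemma resolvent_equation:
  assumes "a > 0" "t > 0"
  shows "resolvent a t + (\<Sum>j\<in>I. p j * resolvent (a + b j) t) = rl_kernel a t"
proof -
  have sm: "summable (\<lambda>n. (- 1) ^ n * iterated_conv n (a + b j) t)" if "j \<in> I" for j
    using that assms b_pos by (intro summable_alternating_iterated_conv) (auto simp: add_pos_pos)
  have "(\<Sum>n. (- 1) ^ Suc n * iterated_conv (Suc n) a t) = (\<Sum>n. - (\<Sum>j\<in>I. p j * ((- 1) ^ n * iterated_conv n (a + b j) t)))"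
    by (simp add: sum_distrib_left mult_ac flip: sum_negf)
  also have "\<dots> = - (\<Sum>n. \<Sum>j\<in>I. p j * ((- 1) ^ n * iterated_conv n (a + b j) t))"
    by (intro suminf_minus summable_sum summable_mult sm)
  also have "(\<Sum>n. \<Sum>j\<in>I. p j * ((- 1) ^ n * iterated_conv n (a + b j) t)) = (\<Sum>j\<in>I. \<Sum>n. p j * ((- 1) ^ n * iterated_conv n (a + b j) t))"
    by (intro suminf_sum summable_mult sm)
  also have "\<dots> = (\<Sum>j\<in>I. p j * resolvent (a + b j) t)"
    unfolding resolvent_def by (intro sum.cong refl suminf_mult sm)
  finally show ?thesis
    using suminf_split_head[OF summable_alternating_iterated_conv[OF assms]] unfolding resolvent_def by simp
qed

text \<open>
  The bound of \<open>iterated_conv_bound\<close> is uniform for \<open>t\<close> in a compact part of \<open>{0<..}\<close>, so the Weierstrass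
  test applies there.  It blows up at \<open>0\<close>, as does the leading term \<open>w\<^sub>a\<close> for \<open>a < 1\<close>.
\<close>

lemma continuous_on_resolvent:
  assumes "a > 0"
  shows "continuous_on {0<..} (resolvent a)"
proof -
  obtain S where S: "S > 0" "0 \<le> ratio S" "ratio S < 1" using obtain_small_ratio .
  have "isCont (resolvent a) t" if "t > 0" for t
  proof -
    let ?K = "{t/2<..<2*t}"
    have "uniform_limit ?K (\<lambda>N t. \<Sum>n<N. (- 1) ^ n * iterated_conv n a t) (resolvent a) sequentially"
      unfolding resolvent_def
    proof (rule Weierstrass_m_test)
      show "summable (\<lambda>n. exp (exp 1 * S * (2 * t)) / (t/2) * S powr (- a) * ratio S ^ n)"
        using S by (intro summable_mult summable_geometric) auto
      fix n x assume x: "x \<in> ?K"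
      have "norm ((- 1) ^ n * iterated_conv n a x) = iterated_conv n a x"
        using iterated_conv_nonneg[OF assms] by (simp add: abs_mult power_abs)
      also have "\<dots> \<le> exp (exp 1 * S * x) / x * S powr (- a) * ratio S ^ n"
        using x that S assms by (intro iterated_conv_bound) auto
      also have "\<dots> \<le> exp (exp 1 * S * (2 * t)) / (t/2) * S powr (- a) * ratio S ^ n"
        using x that S by (intro mult_right_mono frac_le) auto
      finally show "norm ((- 1) ^ n * iterated_conv n a x) \<le> exp (exp 1 * S * (2 * t)) / (t/2) * S powr (- a) * ratio S ^ n" .
    qed
    moreover have "\<forall>\<^sub>F N in sequentially. continuous_on ?K (\<lambda>t. \<Sum>n<N. (- 1) ^ n * iterated_conv n a t)"
      using that by (intro always_eventually allI continuous_intros continuous_on_subset[OF continuous_on_iterated_conv]) auto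
    ultimately have "continuous_on ?K (resolvent a)"
      by (intro uniform_limit_theorem) auto
    then show ?thesis using that by (simp add: continuous_on_eq_continuous_at)
  qed
  then show ?thesis by (simp add: continuous_on_eq_continuous_at)
qed

text \<open>
  Term by term this is \<open>iterated_conv_convolution\<close>.  The exchange of sum and integral is justified by the
  series of norms, which is the convergent series of \<open>iterated_conv n (a + c) t\<close>.
\<close>

lemma resolvent_convolution:
  assumes "c > 0" "a > 0" "t > 0"
  shows "(\<lambda>s. rl_kernel c (t - s) * resolvent a s) absolutely_integrable_on {0<..<t}"
    and "(LINT s:{0<..<t}|lebesgue. rl_kernel c (t - s) * resolvent a s) = resolvent (a + c) t"
proof -
  define g where "g n s = rl_kernel c (t - s) * iterated_conv n a s" for n s
  define f where "f n s = indicator {0<..<t} s *\<^sub>R ((- 1) ^ n * g n s)" for n s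
  have g_nonneg: "0 \<le> g n s" for n s
    using assms by (simp add: g_def rl_kernel_nonneg iterated_conv_nonneg)
  have hi: "(g n has_integral iterated_conv n (a + c) t) {0<..<t}" for n
    unfolding g_def by (rule iterated_conv_convolution[OF assms])
  have ai: "g n absolutely_integrable_on {0<..<t}" for n
    using hi g_nonneg by (intro nonnegative_absolutely_integrable_1) (auto simp: integrable_on_def)
  have li: "(LINT s:{0<..<t}|lebesgue. g n s) = iterated_conv n (a + c) t" for n
    using set_lebesgue_integral_eq_integral(2)[OF ai] hi by (simp add: integral_unique)
  have int_f: "integrable lebesgue (f n)" for n
    using set_integrable_mult_right[OF ai, where a = "(- 1) ^ n"] unfolding f_def set_integrable_def by simp
  have LINT_f: "(\<integral>s. f n s \<partial>lebesgue) = (- 1) ^ n * iterated_conv n (a + c) t" for n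
    using li[of n] unfolding f_def set_lebesgue_integral_def
    by (simp add: mult.left_commute)
  have norm_f: "norm (f n s) = indicator {0<..<t} s *\<^sub>R g n s" for n s
    using g_nonneg[of n s] by (simp add: f_def abs_mult power_abs indicator_def)
  have LINT_norm: "(\<integral>s. norm (f n s) \<partial>lebesgue) = iterated_conv n (a + c) t" for n
    using li[of n] unfolding norm_f set_lebesgue_integral_def .
  have sum1: "summable (\<lambda>n. norm (f n s))" for s
  proof (cases "s \<in> {0<..<t}")
    case True
    then show ?thesis unfolding norm_f g_def
      using summable_mult[OF summable_iterated_conv[of a s]] assms by simp
  next
    case False
    then have "norm (f n s) = 0" for n by (simp only: norm_f) simp
    then show ?thesis by simp
  qed
  have sum2: "summable (\<lambda>n. \<integral>s. norm (f n s) \<partial>lebesgue)"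
    unfolding LINT_norm using assms by (intro summable_iterated_conv) auto
  have lim: "(\<Sum>n. f n s) = indicator {0<..<t} s *\<^sub>R (rl_kernel c (t - s) * resolvent a s)" for s
  proof (cases "s \<in> {0<..<t}")
    case True
    then have "(\<Sum>n. rl_kernel c (t - s) * ((- 1) ^ n * iterated_conv n a s)) = rl_kernel c (t - s) * resolvent a s"
      unfolding resolvent_def using assms by (intro suminf_mult summable_alternating_iterated_conv) auto
    then show ?thesis using True by (simp add: f_def g_def mult_ac)
  qed (simp add: f_def)
  show "(\<lambda>s. rl_kernel c (t - s) * resolvent a s) absolutely_integrable_on {0<..<t}"
    using integrable_suminf[OF int_f AE_I2[OF sum1] sum2] unfolding lim set_integrable_def .
  show "(LINT s:{0<..<t}|lebesgue. rl_kernel c (t - s) * resolvent a s) = resolvent (a + c) t"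
    using integral_suminf[OF int_f AE_I2[OF sum1] sum2] 
    unfolding lim set_lebesgue_integral_def LINT_f resolvent_def .
qed

text \<open>
  For \<open>\<alpha> < 1\<close> the Caputo derivative convolves the derivative with \<open>w\<^bsub>1-\<alpha>\<^esub>\<close>.  For \<open>\<alpha> = 1\<close> it
  returns the derivative itself, which is the same formula read with \<open>1 - \<alpha> = 0\<close>, so that no case
  distinction is left in the conclusion.
\<close>

lemma caputo_resolvent:
  assumes "0 < \<alpha>" "\<alpha> \<le> 1" "0 < a" "0 < t"
  shows "caputo_exists \<alpha> (\<lambda>s. c * resolvent a s) t"
    and "caputo \<alpha> (\<lambda>s. c * resolvent a s) t = c * resolvent (a + 1 - \<alpha>) t"
proof -
  have eq: "(t - s) powr (- \<alpha>) * (c * resolvent a s)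
      = (c * Gamma (1 - \<alpha>)) * (rl_kernel (1 - \<alpha>) (t - s) * resolvent a s)" if "\<alpha> < 1" for s
  proof -
    have "Gamma (1 - \<alpha>) > 0" using that by (simp add: Gamma_real_pos)
    then show ?thesis by (simp add: rl_kernel_def)
  qed
  show "caputo_exists \<alpha> (\<lambda>s. c * resolvent a s) t"
    unfolding caputo_exists_def
  proof
    assume "\<alpha> < 1"
    then show "(\<lambda>s. (t - s) powr (- \<alpha>) * (c * resolvent a s)) absolutely_integrable_on {0<..<t}"
      unfolding eq[OF \<open>\<alpha> < 1\<close>] using assms by (intro set_integrable_mult_right resolvent_convolution) auto
  qed
  show "caputo \<alpha> (\<lambda>s. c * resolvent a s) t = c * resolvent (a + 1 - \<alpha>) t"
  proof (cases "\<alpha> = 1")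
    case False
    with assms have "\<alpha> < 1" by simp
    then have "Gamma (1 - \<alpha>) \<noteq> 0"
      using Gamma_real_pos[of "1 - \<alpha>"] by (metis diff_gt_0_iff_gt less_irrefl)
    with \<open>\<alpha> < 1\<close> show ?thesis
      using resolvent_convolution(2)[of "1 - \<alpha>" a t] assms
      by (simp add: caputo_def eq set_integral_mult_right add_diff_eq)
  qed (simp add: caputo_def)
qed

lemma has_integral_resolvent:
  assumes "0 < a" "0 < t"
  shows "(resolvent a has_integral resolvent (a + 1) t) {0..t}"
proof -
  note conv = resolvent_convolution[OF zero_less_one assms]
  have "((\<lambda>s. rl_kernel 1 (t - s) * resolvent a s) has_integral resolvent (a + 1) t) {0<..<t}"
    using set_lebesgue_integral_eq_integral[OF conv(1)] conv(2) by (simp add: has_integral_iff)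
  then have "(resolvent a has_integral resolvent (a + 1) t) {0<..<t}"
    by (rule has_integral_eq[rotated]) (simp add: rl_kernel_1)
  then show ?thesis by (simp add: has_integral_Icc_iff_Ioo)
qed

lemma has_real_derivative_integral_resolvent:
  assumes "0 < a" "0 < t"
  shows "((\<lambda>u. integral {0..u} (resolvent a)) has_real_derivative resolvent a t) (at t)"
proof -
  have "resolvent a integrable_on {0..t + 1}"
    using has_integral_resolvent[of a "t + 1"] assms by (auto simp: integrable_on_def)
  moreover have "isCont (resolvent a) t"
    using continuous_on_resolvent[OF assms(1)] assms(2) by (simp add: continuous_on_eq_continuous_at)
  ultimately have "((\<lambda>u. integral {0..u} (resolvent a)) has_vector_derivative resolvent a t) (at t within ({0..t + 1} - {}))"
    using assms(2) by (intro integral_has_vector_derivative_continuous_at) (auto simp: continuous_at_imp_continuous_at_within)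
  moreover have "at t within ({0..t + 1} - {}) = at t"
    using at_within_Icc_at[of 0 t "t + 1"] assms(2) by simp
  ultimately show ?thesis
    by (simp only: has_real_derivative_iff_has_vector_derivative)
qed

end

section \<open>Weak derivatives of continuously differentiable functions\<close>

lemma test_function_deriv:
  assumes "test_function S \<phi>"
  shows "(\<phi> has_real_derivative deriv \<phi> x) (at x)" "isCont (deriv \<phi>) x"
proof -
  have "(deriv ^^ 0) \<phi> field_differentiable (at x)" "(deriv ^^ 1) \<phi> field_differentiable (at x)"
    using assms unfolding test_function_def by blast+
  then show "(\<phi> has_real_derivative deriv \<phi> x) (at x)" "isCont (deriv \<phi>) x"
    by (simp_all add: field_differentiable_derivI field_differentiable_imp_continuous_at)
qed

lemma locally_integrable_continuous_on:
  assumes "continuous_on S f"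
  shows "locally_integrable S f"
  unfolding locally_integrable_def set_integrable_def
proof (intro allI impI)
  fix K assume K: "compact K \<and> K \<subseteq> S"
  then have "integrable lborel (\<lambda>x. indicator K x *\<^sub>R f x)"
    using assms by (intro borel_integrable_compact) (auto intro: continuous_on_subset)
  then show "integrable lebesgue (\<lambda>x. indicator K x *\<^sub>R f x)"
    using integrable_completion borel_measurable_integrable by metis
qed

text \<open>
  Since \<open>y\<close> and \<open>v\<close> may be unbounded near the end points, the integrals are first cut down to a
  compact interval \<open>{c..d}\<close> with the support of the test function in its interior, where the
  boundary terms of the integration by parts vanish.
\<close>

lemma weak_derivative_of_C1:
  assumes der: "\<And>x. x \<in> {a<..<b} \<Longrightarrow> (y has_real_derivative v x) (at x)"
    and cont: "continuous_on {a<..<b} v"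
  shows "weak_derivative {a<..<b} y v"
  unfolding weak_derivative_def
proof (intro conjI allI impI)
  have conty: "continuous_on {a<..<b} y"
    using der DERIV_isCont by (intro continuous_at_imp_continuous_on) blast
  show "locally_integrable {a<..<b} y" "locally_integrable {a<..<b} v"
    by (intro locally_integrable_continuous_on conty cont)+
  fix \<phi> assume \<phi>: "test_function {a<..<b} \<phi>"
  then obtain K where K: "compact K" "K \<subseteq> {a<..<b}" "\<And>x. x \<notin> K \<Longrightarrow> \<phi> x = 0"
    unfolding test_function_def by blast
  show "(LINT x:{a<..<b}|lebesgue. y x * deriv \<phi> x) = - (LINT x:{a<..<b}|lebesgue. v x * \<phi> x)"
  proof (cases "a < b")
    case False
    then show ?thesis by (simp add: set_lebesgue_integral_def)
  next
    case True
    have deriv0: "deriv \<phi> x = 0" if "x \<notin> K" for x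
    proof -
      have "((\<lambda>x. 0) has_real_derivative 0) (at x)" by simp
      then have "(\<phi> has_real_derivative 0) (at x)"
        by (rule has_field_derivative_transform_within_open[of _ _ _ "- K"])
          (use K that in \<open>auto simp: compact_imp_closed open_Compl\<close>)
      then show ?thesis by (rule DERIV_imp_deriv)
    qed
    \<comment> \<open>Adding the midpoint makes the support nonempty, so that it has a least and a greatest element.\<close>
    let ?K = "insert ((a + b) / 2) K"
    have K': "compact ?K" "?K \<noteq> {}" "?K \<subseteq> {a<..<b}" using K True by (auto simp: compact_insert)
    obtain lo where lo: "lo \<in> ?K" "\<And>x. x \<in> ?K \<Longrightarrow> lo \<le> x"
      using compact_attains_inf[OF K'(1,2)] by blast
    obtain hi where hi: "hi \<in> ?K" "\<And>x. x \<in> ?K \<Longrightarrow> x \<le> hi"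
      using compact_attains_sup[OF K'(1,2)] by blast
    define c d where "c = (a + lo) / 2" and "d = (hi + b) / 2"
    have lohi: "a < lo" "lo \<le> hi" "hi < b" using lo hi K' by (meson greaterThanLessThan_iff subsetD)+
    have cd: "a < c" "c < lo" "hi < d" "d < b" "c \<le> d"
      using lohi by (auto simp: c_def d_def field_simps)
    have sub: "{c..d} \<subseteq> {a<..<b}" using cd by auto
    have Kcd: "K \<subseteq> {c..d}" using lo(2) hi(2) cd by (force intro: order.trans less_imp_le)
    have cK: "c \<notin> K" "d \<notin> K" using lo(2) hi(2) cd by force+
    have red: "(LINT x:{a<..<b}|lebesgue. f x) = integral {c..d} f"
      if "continuous_on {c..d} f" "\<And>x. x \<notin> K \<Longrightarrow> f x = 0" for f :: "real \<Rightarrow> real"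
    proof -
      have "(LINT x:{a<..<b}|lebesgue. f x) = (LINT x:{c..d}|lebesgue. f x)"
        unfolding set_lebesgue_integral_def
      proof (intro Bochner_Integration.integral_cong refl)
        fix x
        show "indicator {a<..<b} x *\<^sub>R f x = indicator {c..d} x *\<^sub>R f x"
          using that(2)[of x] sub Kcd by (cases "x \<in> K") (auto simp: indicator_def)
      qed
      also have "\<dots> = integral {c..d} f"
        by (intro set_lebesgue_integral_eq_integral absolutely_integrable_continuous_real that)
      finally show ?thesis .
    qed
    have c\<phi>: "continuous_on {c..d} \<phi>" "continuous_on {c..d} (deriv \<phi>)"
      using test_function_deriv[OF \<phi>]
      by (auto intro!: continuous_at_imp_continuous_on intro: DERIV_isCont)
    have cy: "continuous_on {c..d} y" "continuous_on {c..d} v"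
      using conty cont sub continuous_on_subset by blast+
    have c1: "continuous_on {c..d} (\<lambda>x. y x * deriv \<phi> x)"
      and c2: "continuous_on {c..d} (\<lambda>x. v x * \<phi> x)"
      by (intro continuous_intros c\<phi> cy)+
    have "((\<lambda>x. y x * deriv \<phi> x + v x * \<phi> x) has_integral y d * \<phi> d - y c * \<phi> c) {c..d}"
    proof (rule fundamental_theorem_of_calculus[OF \<open>c \<le> d\<close>])
      fix x assume "x \<in> {c..d}"
      then have "(y has_real_derivative v x) (at x)" using der sub by auto
      from DERIV_mult[OF this test_function_deriv(1)[OF \<phi>]]
      show "((\<lambda>x. y x * \<phi> x) has_vector_derivative y x * deriv \<phi> x + v x * \<phi> x) (at x within {c..d})"
        by (simp add: has_real_derivative_iff_has_vector_derivative[symmetric] add.commute mult.commute has_field_derivative_at_within)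
    qed
    moreover have "((\<lambda>x. y x * deriv \<phi> x + v x * \<phi> x) has_integral
        integral {c..d} (\<lambda>x. y x * deriv \<phi> x) + integral {c..d} (\<lambda>x. v x * \<phi> x)) {c..d}"
      by (intro has_integral_add integrable_integral integrable_continuous_interval c1 c2)
    ultimately have "integral {c..d} (\<lambda>x. y x * deriv \<phi> x) + integral {c..d} (\<lambda>x. v x * \<phi> x)
        = y d * \<phi> d - y c * \<phi> c"
      by (rule has_integral_unique[rotated])
    also have "\<dots> = 0"
      using K(3) cK by simp
    finally have "integral {c..d} (\<lambda>x. y x * deriv \<phi> x) + integral {c..d} (\<lambda>x. v x * \<phi> x) = 0" .
    then show ?thesis
      using red[OF c1] red[OF c2] deriv0 K(3) by simp
  qed
qed

lemma continuous_on_Icc_in_L_inf: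
  assumes "continuous_on {a..b} f"
  shows "f \<in> L_inf {a<..<b}"
  unfolding L_inf_def
proof (intro CollectI conjI)
  have "continuous_on {a<..<b} f" by (rule continuous_on_subset[OF assms]) auto
  then have "(\<lambda>x. indicator {a<..<b} x *\<^sub>R f x) \<in> borel_measurable borel"
    by (intro borel_measurable_continuous_on_indicator) auto
  then show "set_borel_measurable lebesgue {a<..<b} f"
    unfolding set_borel_measurable_def by (simp add: measurable_completion)
  have "bounded (f ` {a..b})"
    by (intro compact_imp_bounded compact_continuous_image assms compact_Icc)
  then obtain C where "\<And>x. x \<in> {a..b} \<Longrightarrow> \<bar>f x\<bar> \<le> C"
    unfolding bounded_iff by (metis imageI real_norm_def)
  then show "\<exists>C. AE x in lebesgue. x \<in> {a<..<b} \<longrightarrow> \<bar>f x\<bar> \<le> C"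
    by (intro exI[of _ C] AE_I2) auto
qed

section \<open>Caputo derivatives at a minimum\<close>

text \<open>
  For \<open>a < 1\<close>, integration by parts of \<open>(t - s) powr (- a) * v s\<close> over \<open>{0..u}\<close> with \<open>u < t\<close> moves
  the derivative to the kernel.  The new integrand and the boundary term at \<open>0\<close> have the favourable
  sign because \<open>y s - y t \<ge> 0\<close>.  What remains is the boundary term at \<open>u\<close>, which tends to \<open>0\<close> as
  \<open>u\<close> tends to \<open>t\<close>: up to sign it is \<open>(t - u) powr (1 - a)\<close> times a difference quotient of \<open>y\<close> at \<open>t\<close>.
  For \<open>a = 1\<close> the claim is about a one-sided difference quotient.
\<close>

lemma caputo_nonpos_at_minimum:
  assumes t: "0 < t" and a: "0 < a" "a \<le> 1"
    and conty: "continuous_on {0..t} y"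
    and der: "\<And>s. s \<in> {0<..t} \<Longrightarrow> (y has_real_derivative v s) (at s)"
    and ex: "caputo_exists a v t"
    and min: "\<And>s. s \<in> {0..t} \<Longrightarrow> y t \<le> y s"
  shows "caputo a v t \<le> 0"
proof (cases "a = 1")
  case True
  have "v t \<le> 0"
  proof (rule ccontr)
    assume "\<not> v t \<le> 0"
    with der[of t] t obtain d where d: "d > 0" "\<And>h. 0 < h \<Longrightarrow> h < d \<Longrightarrow> y (t - h) < y t"
      using DERIV_pos_inc_left[of y "v t" t] by auto
    define h where "h = min (d / 2) t"
    have "0 < h" "h < d" "t - h \<in> {0..t}" using d(1) t by (auto simp: h_def)
    with d(2)[of h] min[of "t - h"] show False by auto
  qed
  then show ?thesis using True by (simp add: caputo_def)
next
  case False
  with a have a1: "a < 1" by simp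
  define f where "f s = (t - s) powr (- a) * v s" for s
  have ai: "f absolutely_integrable_on {0<..<t}"
    using ex a1 unfolding caputo_exists_def f_def by simp
  then have int: "f integrable_on {0..t}"
    using set_lebesgue_integral_eq_integral(1) integrable_on_Icc_iff_Ioo by blast
  have le: "integral {0..u} f \<le> (t - u) powr (- a) * (y u - y t)" if u: "u \<in> {0<..<t}" for u
  proof -
    define F where "F s = (t - s) powr (- a) * (y s - y t)" for s
    define F' where "F' s = f s + a * (t - s) powr (- a - 1) * (y s - y t)" for s
    have "(F' has_integral F u - F 0) {0..u}"
    proof (rule fundamental_theorem_of_calculus_interior)
      show "0 \<le> u" using u by simp
      show "continuous_on {0..u} F"
        unfolding F_def using u
        by (intro continuous_intros continuous_on_subset[OF conty]) auto
      fix s assume s: "s \<in> {0<..<u}"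
      have "((\<lambda>s. (t - s) powr (- a)) has_real_derivative a * (t - s) powr (- a - 1)) (at s)"
        using s u by (auto intro!: derivative_eq_intros)
      moreover have "((\<lambda>s. y s - y t) has_real_derivative v s) (at s)"
        using der[of s] s u by (auto intro!: derivative_eq_intros)
      ultimately have "(F has_real_derivative F' s) (at s)"
        unfolding F_def F'_def f_def by (rule DERIV_cong[OF DERIV_mult]) (simp add: mult_ac)
      then show "(F has_vector_derivative F' s) (at s)"
        by (simp add: has_real_derivative_iff_has_vector_derivative)
    qed
    moreover have "(f has_integral integral {0..u} f) {0..u}"
      using int u by (intro integrable_integral integrable_on_subinterval[OF int]) auto
    moreover have "f s \<le> F' s" if "s \<in> {0..u}" for s
      using that min[of s] u a by (simp add: F'_def)
    ultimately have "integral {0..u} f \<le> F u - F 0"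
      by (meson has_integral_le)
    also have "\<dots> \<le> F u" using min[of 0] t by (simp add: F_def)
    finally show ?thesis by (simp add: F_def)
  qed
  have lim1: "((\<lambda>u. integral {0..u} f) \<longlongrightarrow> integral {0..t} f) (at_left t)"
  proof -
    have "continuous_on {0..t} (\<lambda>u. integral {0..u} f)"
      by (rule indefinite_integral_continuous_1[OF int])
    then have "((\<lambda>u. integral {0..u} f) \<longlongrightarrow> integral {0..t} f) (at t within {0..t})"
      using t unfolding continuous_on by auto
    then show ?thesis using t by (simp add: at_within_Icc_at_left)
  qed
  have lim2: "((\<lambda>u. (t - u) powr (- a) * (y u - y t)) \<longlongrightarrow> 0) (at_left t)"
  proof -
    have "((\<lambda>u. (y u - y t) / (u - t)) \<longlongrightarrow> v t) (at_left t)"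
      using der[of t] t by (auto simp: has_field_derivative_iff intro: filterlim_at_split[THEN iffD1, THEN conjunct1])
    moreover have "((\<lambda>u. - ((t - u) powr (1 - a))) \<longlongrightarrow> - ((t - t) powr (1 - a))) (at_left t)"
      using a1 by (intro tendsto_intros tendsto_powr') (auto simp: eventually_at_filter)
    ultimately have "((\<lambda>u. - ((t - u) powr (1 - a)) * ((y u - y t) / (u - t))) \<longlongrightarrow> - ((t - t) powr (1 - a)) * v t) (at_left t)"
      by (intro tendsto_mult)
    then have "((\<lambda>u. - ((t - u) powr (1 - a)) * ((y u - y t) / (u - t))) \<longlongrightarrow> 0) (at_left t)"
      by simp
    moreover have "\<forall>\<^sub>F u in at_left t. - ((t - u) powr (1 - a)) * ((y u - y t) / (u - t)) = (t - u) powr (- a) * (y u - y t)"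
      unfolding eventually_at_filter
    proof (intro always_eventually allI impI)
      fix u assume "u \<noteq> t" "u \<in> {..<t}"
      then have "(t - u) powr (1 - a) = (t - u) * (t - u) powr (- a)"
        by (simp add: powr_diff powr_minus divide_inverse)
      moreover define d where "d = (y u - y t) / (u - t)"
      moreover have "y u - y t = d * (u - t)"
        using \<open>u \<noteq> t\<close> by (simp add: d_def)
      ultimately show "- ((t - u) powr (1 - a)) * ((y u - y t) / (u - t)) = (t - u) powr (- a) * (y u - y t)"
        by (simp flip: d_def) (simp add: algebra_simps)
    qed
    ultimately show ?thesis by (rule Lim_transform_eventually)
  qed
  have "integral {0..t} f \<le> 0"
  proof (rule tendsto_le[OF _ lim2 lim1])
    show "\<forall>\<^sub>F u in at_left t. integral {0..u} f \<le> (t - u) powr (- a) * (y u - y t)"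
      by (rule eventually_at_leftI[of 0]) (use le t in auto)
  qed simp
  moreover have "(LINT s:{0<..<t}|lebesgue. f s) = integral {0..t} f"
    using set_lebesgue_integral_eq_integral(2)[OF ai] by (simp add: integral_open_interval_real)
  ultimately show ?thesis
    using a1 Gamma_real_pos[of "1 - a"] unfolding caputo_def f_def
    by (simp add: divide_nonpos_pos)
qed

text \<open>
  At a negative minimum the Caputo terms are nonpositive and \<open>lam * y t\<close> is negative, so that they
  cannot add up to \<open>0\<close>.
\<close>

lemma nonneg_of_multiterm_equation:
  assumes T: "0 < T" and "0 < lam"
    and \<alpha>: "\<And>i. i \<in> {1..l} \<Longrightarrow> 0 < \<alpha> i \<and> \<alpha> i \<le> 1"
    and q: "\<And>i. i \<in> {1..l} \<Longrightarrow> 0 \<le> q i"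
    and conty: "continuous_on {0..T} y" and "0 \<le> y 0"
    and der: "\<And>s. s \<in> {0<..T} \<Longrightarrow> (y has_real_derivative v s) (at s)"
    and ex: "\<And>t i. t \<in> {0<..T} \<Longrightarrow> i \<in> {1..l} \<Longrightarrow> caputo_exists (\<alpha> i) v t"
    and eq: "\<And>t. t \<in> {0<..T} \<Longrightarrow> (\<Sum>i=1..l. q i * caputo (\<alpha> i) v t) + lam * y t = 0"
    and t: "t \<in> {0..T}"
  shows "0 \<le> y t"
proof -
  have "{0..T} \<noteq> {}" using T by simp
  then obtain m where m: "m \<in> {0..T}" "\<And>s. s \<in> {0..T} \<Longrightarrow> y m \<le> y s"
    using continuous_attains_inf[OF compact_Icc _ conty] by blast
  have "0 \<le> y m"
  proof (rule ccontr)
    assume neg: "\<not> 0 \<le> y m"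
    with \<open>0 \<le> y 0\<close> m have m0: "m \<in> {0<..T}" by (cases "m = 0") auto
    have "caputo (\<alpha> i) v m \<le> 0" if "i \<in> {1..l}" for i
      using m0 m(2) \<alpha>[OF that] ex[OF m0 that] der
      by (intro caputo_nonpos_at_minimum[where y = y] continuous_on_subset[OF conty]) auto
    then have "(\<Sum>i=1..l. q i * caputo (\<alpha> i) v m) \<le> 0"
      using q by (intro sum_nonpos mult_nonneg_nonpos) auto
    moreover have "lam * y m < 0" using \<open>0 < lam\<close> neg by (simp add: mult_pos_neg)
    ultimately show False using eq[OF m0] by linarith
  qed
  with m(2)[OF t] show ?thesis by simp
qed

section \<open>The multiterm equation\<close>

theorem lemmaA3:
  fixes T lam :: real and l :: nat and \<alpha> q :: "nat \<Rightarrow> real"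
  assumes "T > 0"
    and "l \<ge> 1"
    and "\<forall>i\<in>{1..l}. 0 < \<alpha> i"
    and "strict_antimono_on {1..l} \<alpha>"
    and "\<alpha> 1 \<le> 1"
    and "\<forall>i\<in>{1..l}. q i \<ge> 0"
    and "(\<Sum>i=1..l. q i) > 0"
    and "lam \<ge> 0"
  shows "\<exists>y. multiterm_solution T l \<alpha> q lam y \<and> y 0 = 1 \<and> (\<forall>t\<in>{0..T}. y t \<ge> 0)"
proof -
  have less: "\<alpha> j < \<alpha> i" if "i \<in> {1..l}" "j \<in> {1..l}" "i < j" for i j
    using assms(4) that by (auto simp: monotone_on_def)
  have \<alpha>: "0 < \<alpha> i \<and> \<alpha> i \<le> 1" if "i \<in> {1..l}" for i
    using assms(3,5) that less[of 1 i] by (cases "i = 1") auto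
  obtain k where k: "k \<in> {1..l}" "q k > 0"
    using assms(7) by (metis not_le sum_nonpos)
  \<comment> \<open>The orders decrease with the index, so the least index with a positive coefficient belongs
    to the highest order that occurs.\<close>
  define m where "m = (LEAST i. i \<in> {1..l} \<and> q i > 0)"
  have m: "m \<in> {1..l}" "q m > 0"
    unfolding m_def using LeastI[of "\<lambda>i. i \<in> {1..l} \<and> q i > 0" k] k by auto
  have m_least: "m \<le> i" if "i \<in> {1..l}" "q i > 0" for i
    unfolding m_def using that by (intro Least_le) auto
  define J where "J = {i \<in> {1..l}. i \<noteq> m \<and> q i > 0}"
  \<comment> \<open>Indices start at \<open>1\<close>, which leaves \<open>0\<close> free for the term of order zero.\<close>
  define p where "p i = (if i = 0 then lam else q i) / q m" for i
  define b where "b i = \<alpha> m - (if i = 0 then 0 else \<alpha> i)" for i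
  have J0: "0 \<notin> J" "finite J" by (auto simp: J_def)
  interpret volterra_kernel "insert 0 J" p b
  proof
    show "finite (insert 0 J)" by (simp add: J_def)
    fix j assume j: "j \<in> insert 0 J"
    then show "0 \<le> p j" using assms(8) m by (auto simp: p_def J_def)
    show "0 < b j"
    proof (cases "j = 0")
      case True
      then show ?thesis using \<alpha>[OF m(1)] by (simp add: b_def)
    next
      case False
      then have "j \<in> {1..l}" "j \<noteq> m" "q j > 0" using j by (auto simp: J_def)
      then show ?thesis using less[OF m(1)] m_least[of j] False by (auto simp: b_def)
    qed
  qed
  define c where "c = - (lam / q m)"
  define v where "v = (\<lambda>s. c * resolvent (\<alpha> m) s)"
  define y where "y t = 1 + c * integral {0..t} (resolvent (\<alpha> m))" for t
  have \<beta>: "0 < \<alpha> m" using \<alpha>[OF m(1)] by simp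
  have y0: "y 0 = 1" by (simp add: y_def)
  have y_pos: "y t = 1 + c * resolvent (\<alpha> m + 1) t" if "0 < t" for t
    using has_integral_resolvent[OF \<beta> that] by (simp add: y_def integral_unique)
  have conty: "continuous_on {0..T} y"
    unfolding y_def using has_integral_resolvent[OF \<beta> \<open>T > 0\<close>]
    by (intro continuous_intros indefinite_integral_continuous_1) (auto simp: integrable_on_def)
  have der: "(y has_real_derivative v t) (at t)" if "0 < t" for t
    unfolding y_def v_def using has_real_derivative_integral_resolvent[OF \<beta> that]
    by (auto intro!: derivative_eq_intros)
  have contv: "continuous_on {0<..} v"
    unfolding v_def by (intro continuous_intros continuous_on_resolvent \<beta>)
  have ex: "caputo_exists (\<alpha> i) v t" if "i \<in> {1..l}" "0 < t" for i t
    unfolding v_def using \<alpha>[OF that(1)] \<beta> that by (intro caputo_resolvent) auto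
  have cap: "caputo (\<alpha> i) v t = c * resolvent (\<alpha> m + 1 - \<alpha> i) t" if "i \<in> {1..l}" "0 < t" for i t
    unfolding v_def using \<alpha>[OF that(1)] \<beta> that by (intro caputo_resolvent) auto
  have eqn: "(\<Sum>i=1..l. q i * caputo (\<alpha> i) v t) + lam * y t = 0" if t: "0 < t" for t
  proof -
    have "(\<Sum>i=1..l. q i * caputo (\<alpha> i) v t) = (\<Sum>i\<in>insert m J. q i * caputo (\<alpha> i) v t)"
      using assms(6) m by (intro sum.mono_neutral_right) (force simp: J_def)+
    also have "\<dots> = q m * caputo (\<alpha> m) v t + (\<Sum>i\<in>J. q i * caputo (\<alpha> i) v t)"
      by (subst sum.insert) (auto simp: J_def)
    also have "(\<Sum>i\<in>J. q i * caputo (\<alpha> i) v t) = (\<Sum>i\<in>J. q m * c * (p i * resolvent (1 + b i) t))"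
    proof (rule sum.cong[OF refl])
      fix i assume "i \<in> J"
      then have i: "i \<in> {1..l}" "i \<noteq> 0" by (auto simp: J_def)
      have e: "1 + b i = \<alpha> m + 1 - \<alpha> i" using i by (simp add: b_def)
      show "q i * caputo (\<alpha> i) v t = q m * c * (p i * resolvent (1 + b i) t)"
        unfolding e cap[OF i(1) t] using i m(2) by (simp add: p_def)
    qed
    also have "\<dots> = q m * c * (\<Sum>i\<in>J. p i * resolvent (1 + b i) t)"
      by (rule sum_distrib_left[symmetric])
    also have "q m * caputo (\<alpha> m) v t = q m * c * resolvent 1 t"
      using cap[OF m(1) t] by simp
    finally have 1: "(\<Sum>i=1..l. q i * caputo (\<alpha> i) v t)
        = q m * c * (resolvent 1 t + (\<Sum>i\<in>J. p i * resolvent (1 + b i) t))"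
      by (simp add: distrib_left)
    \<comment> \<open>The index \<open>0\<close> contributes \<open>(lam / q m) * R\<^bsub>1+\<beta>\<^esub>\<close>, which equals \<open>1 - y t\<close>.\<close>
    have "resolvent 1 t + (p 0 * resolvent (1 + b 0) t + (\<Sum>i\<in>J. p i * resolvent (1 + b i) t)) = 1"
      using resolvent_equation[OF zero_less_one t] J0 rl_kernel_1[OF t] by simp
    then have "resolvent 1 t + (\<Sum>i\<in>J. p i * resolvent (1 + b i) t) = 1 - lam / q m * resolvent (\<alpha> m + 1) t"
      by (simp add: p_def b_def add.commute)
    then have "(\<Sum>i=1..l. q i * caputo (\<alpha> i) v t) = - lam * (1 - lam / q m * resolvent (\<alpha> m + 1) t)"
      using 1 m(2) by (simp add: c_def)
    also have "1 - lam / q m * resolvent (\<alpha> m + 1) t = y t"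
      using y_pos[OF t] by (simp add: c_def)
    finally show ?thesis by simp
  qed
  have W: "y \<in> W1_inf {\<epsilon><..<t}" if "0 < \<epsilon>" "\<epsilon> < t" "t \<le> T" for \<epsilon> t
    unfolding W1_inf_def
  proof (intro CollectI conjI bexI)
    show "y \<in> L_inf {\<epsilon><..<t}"
      using that by (intro continuous_on_Icc_in_L_inf continuous_on_subset[OF conty]) auto
    show "v \<in> L_inf {\<epsilon><..<t}"
      using that by (intro continuous_on_Icc_in_L_inf continuous_on_subset[OF contv]) auto
    show "weak_derivative {\<epsilon><..<t} y v"
      using that by (intro weak_derivative_of_C1 der continuous_on_subset[OF contv]) auto
  qed
  have "multiterm_solution T l \<alpha> q lam y"
    unfolding multiterm_solution_def
  proof (intro conjI exI[of _ v])
    show "weak_derivative {0<..<T} y v"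
      by (intro weak_derivative_of_C1 der continuous_on_subset[OF contv]) auto
    show "\<alpha> 1 = 1 \<longrightarrow> (\<forall>t\<in>{0<..T}. continuous (at_left t) v)"
      using contv by (auto simp: continuous_on_eq_continuous_at intro: continuous_at_imp_continuous_at_within)
  qed (use conty W ex eqn in auto)
  moreover have "y t \<ge> 0" if "t \<in> {0..T}" for t
  proof (cases "lam = 0")
    case True
    then show ?thesis by (simp add: y_def c_def)
  next
    case False
    show ?thesis
    proof (rule nonneg_of_multiterm_equation[of T lam l \<alpha> q y v])
      show "0 < lam" using False assms(8) by simp
    qed (use assms(1,6) \<alpha> conty y0 der ex eqn that in auto)
  qed
  ultimately show ?thesis using y0 by blast
qed

end
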